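(* For every positive integer $n$, $$\tau(n)=\frac{\displaystyle\sum_{\substack{1\le k\le n\\ \gcd(k,n)=1}}\gcd(k-1,n)}{\displaystyle\sum_{k=1}^{n}\gcd(k,n)\,\cos\left(\frac{2\pi k}{n}\right)} .$$
   Context: $\tau(n)=\sum_{d\mid n}1$ is the number of positive divisors of $n$. The convention $\gcd(0,n)=n$ is used. *)

theory Defs
  imports Complex_Main
begin

definition divisor_tau :: "nat \<Rightarrow> nat" where
  "divisor_tau n = (\<Sum>d | d dvd n. 1)"

end

(*
  Write gcd(m,n) as the sum of totient d over the common divisors d of m and n, and exchange sums.
  In the numerator, the units mod n that are congruent to 1 mod d form a fibre of the surjection
  (Z/n)* -> (Z/d)*; all fibres have totient n / totient d elements, so every divisor d contributes
  totient n, and the numerator is tau(n) * totient n (Menon's identity). In the denominator, d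
  contributes totient d times the sum of the real parts of the (n/d)-th roots of unity, which
  vanishes unless d = n; so the denominator is totient n.
*)
theory Submission
  imports Defs "HOL-Number_Theory.Number_Theory"
begin

text \<open>This is the surjectivity of the reduction map from units mod \<open>n\<close> to units
  mod \<open>d\<close>. It suffices to add to \<open>a\<close> a multiple of \<open>d\<close> chosen
  so that no prime of \<open>n\<close> divides the sum.\<close>

lemma exists_coprime_lift_nat:
  fixes a d n :: nat
  assumes "n > 0" "coprime a d"
  obtains c where "coprime c n" "[c = a] (mod d)"
proof -
  \<comment> \<open>Each prime factor of \<open>n\<close> divides exactly one of \<open>a\<close>
    and \<open>t\<close>. If it divided \<open>a + d * t\<close>, it would divide both
    \<open>a\<close> and \<open>d\<close> in the one case, and be forced to divide \<open>a\<close>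
    in the other.\<close>
  define t where "t = \<Prod>{p \<in> prime_factors n. \<not> p dvd a}"
  have t_dvd: "p dvd t \<longleftrightarrow> \<not> p dvd a" if p: "prime p" "p dvd n" for p
  proof
    assume "p dvd t"
    then obtain q where q: "q \<in> prime_factors n" "\<not> q dvd a" "p dvd q"
      using p(1) unfolding t_def by (subst (asm) prime_dvd_prod_iff) auto
    then have "p = q"
      using p(1) by (auto intro: primes_dvd_imp_eq)
    with q show "\<not> p dvd a" by simp
  next
    assume "\<not> p dvd a"
    then show "p dvd t"
      using p assms(1) unfolding t_def by (intro dvd_prodI) (auto simp: prime_factors_dvd)
  qed
  have "coprime (a + d * t) n"
  proof (rule ccontr)
    assume "\<not> coprime (a + d * t) n"
    then obtain p where p: "prime p" "p dvd a + d * t" "p dvd n"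
      by (metis coprime_iff_gcd_eq_1 gcd_nat.bounded_iff prime_factor_nat)
    show False
    proof (cases "p dvd a")
      case True
      then have "p dvd d * t"
        using p(2) by (simp add: dvd_add_right_iff)
      moreover have "\<not> p dvd t"
        using t_dvd p True by blast
      ultimately have "p dvd d"
        using p(1) prime_dvd_mult_nat by blast
      with True assms(2) p(1) show False
        using coprime_common_divisor_nat not_prime_1 by blast
    next
      case False
      then have "p dvd d * t"
        using t_dvd p by simp
      with False p(2) show False
        by (simp add: dvd_add_left_iff)
    qed
  qed
  moreover have "[a + d * t = a] (mod d)"
    by (simp add: cong_def)
  ultimately show thesis by (rule that)
qed

text \<open>Multiplication by a suitable unit mod \<open>n\<close> injects the first class into the
  second. The roles of \<open>a\<close> and \<open>b\<close> are symmetric, so equality follows by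
  using the bound twice.\<close>

lemma card_totatives_cong_le:
  fixes a b d n :: nat
  assumes "n > 1" "d dvd n" "coprime a d" "coprime b d"
  shows "card {k \<in> totatives n. [k = a] (mod d)} \<le> card {k \<in> totatives n. [k = b] (mod d)}"
proof -
  obtain a' where a': "[a * a' = 1] (mod d)"
    using cong_solve_coprime_nat[OF assms(3)] by auto
  then have "coprime a' d"
    using coprime_iff_invertible_nat[of a' d] by (auto simp: mult.commute)
  then have "coprime (a' * b) d"
    using assms(4) by simp
  \<comment> \<open>The quotient \<open>a' * b\<close> of \<open>b\<close> by \<open>a\<close> is a
    unit only mod \<open>d\<close>. Its lift \<open>c\<close> is a unit mod \<open>n\<close>, which
    makes multiplication by \<open>c\<close> injective mod \<open>n\<close>.\<close>
  then obtain c where c: "coprime c n" "[c = a' * b] (mod d)"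
    using exists_coprime_lift_nat assms(1) by (metis less_trans zero_less_one)
  have ca: "[c * a = b] (mod d)"
  proof -
    have "[c * a = a' * b * a] (mod d)"
      using c(2) by (rule cong_scalar_right)
    also have "a' * b * a = a * a' * b" by simp
    also have "[a * a' * b = 1 * b] (mod d)"
      using a' by (rule cong_scalar_right)
    finally show ?thesis by simp
  qed
  show ?thesis
  proof (rule card_inj_on_le[where f = "\<lambda>k. c * k mod n"])
    show "inj_on (\<lambda>k. c * k mod n) {k \<in> totatives n. [k = a] (mod d)}"
    proof (rule inj_onI)
      fix k l
      assume k: "k \<in> {k \<in> totatives n. [k = a] (mod d)}"
        and l: "l \<in> {k \<in> totatives n. [k = a] (mod d)}"
        and "c * k mod n = c * l mod n"
      then have "[k = l] (mod n)"
        using c(1) cong_mult_lcancel_nat unfolding cong_def by blast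
      moreover have "k < n" "l < n"
        using k l totatives_less assms(1) by auto
      ultimately show "k = l"
        by (simp add: cong_def)
    qed
  next
    show "(\<lambda>k. c * k mod n) ` {k \<in> totatives n. [k = a] (mod d)} \<subseteq> {k \<in> totatives n. [k = b] (mod d)}"
    proof (rule image_subsetI)
      fix k assume k: "k \<in> {k \<in> totatives n. [k = a] (mod d)}"
      then have "coprime (c * k) n"
        using c(1) by (simp add: in_totatives_iff)
      then have cop: "coprime (c * k mod n) n"
        using assms(1) by simp
      then have "c * k mod n > 0"
        using assms(1) by (intro Nat.gr0I) auto
      moreover have "[c * k mod n = b] (mod d)"
      proof -
        have "[c * k mod n = c * k] (mod d)"
          using assms(2) by (simp add: cong_def mod_mod_cancel)
        also have "[c * k = c * a] (mod d)"
          using k by (auto intro: cong_scalar_left)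
        finally show ?thesis
          using ca by (rule cong_trans)
      qed
      ultimately show "c * k mod n \<in> {k \<in> totatives n. [k = b] (mod d)}"
        using cop assms(1) by (simp add: in_totatives_iff less_imp_le)
    qed
  qed simp
qed

text \<open>Reduction mod \<open>d\<close> splits \<open>totatives n\<close> into fibres over
  \<open>totatives d\<close>, all of the same size by \<open>card_totatives_cong_le\<close>.\<close>

lemma card_totatives_cong_mult_totient:
  fixes a d n :: nat
  assumes "n > 1" "d dvd n" "coprime a d"
  shows "card {k \<in> totatives n. [k = a] (mod d)} * totient d = totient n"
\<comment> \<open>Here \<open>totatives 1\<close> is \<open>{1}\<close> while
  \<open>k mod 1 = 0\<close>, so the fibre argument needs \<open>d > 1\<close>.\<close>
proof (cases "d = 1")
  case True
  then show ?thesis by (simp add: totient_def)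
next
  case False
  then have d: "d > 1"
    using assms(1,2) by (metis dvd_pos_nat less_one linorder_neqE_nat not_less_zero order.strict_trans)
  have img: "(\<lambda>k. k mod d) ` totatives n \<subseteq> totatives d"
  proof (rule image_subsetI)
    fix k assume "k \<in> totatives n"
    then have "coprime k d"
      using assms(2) by (meson coprime_divisors dvd_refl in_totatives_iff)
    then have cop: "coprime (k mod d) d"
      using d by simp
    then have "k mod d > 0"
      using d by (intro Nat.gr0I) auto
    with cop d show "k mod d \<in> totatives d"
      by (simp add: in_totatives_iff less_imp_le)
  qed
  have "totient n = (\<Sum>k\<in>totatives n. 1)"
    by (simp add: totient_def)
  also have "\<dots> = (\<Sum>b\<in>totatives d. card {k \<in> totatives n. k mod d = b})"
    using sum_fun_comp[OF finite_totatives finite_totatives img, of "\<lambda>_. 1 :: nat"] by simp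
  also have "\<dots> = (\<Sum>b\<in>totatives d. card {k \<in> totatives n. [k = a] (mod d)})"
  proof (rule sum.cong[OF refl])
    fix b assume b: "b \<in> totatives d"
    then have "b < d" using d by (rule totatives_less)
    then have "{k \<in> totatives n. k mod d = b} = {k \<in> totatives n. [k = b] (mod d)}"
      by (simp add: cong_def)
    moreover have "coprime b d"
      using b by (simp add: in_totatives_iff)
    ultimately show "card {k \<in> totatives n. k mod d = b} = card {k \<in> totatives n. [k = a] (mod d)}"
      using assms by (auto intro!: antisym card_totatives_cong_le)
  qed
  finally show ?thesis
    by (simp add: totient_def)
qed

text \<open>Gauss's divisor sum for \<open>totient\<close>, taken at \<open>gcd m n\<close>. It
  replaces gcd weights by sums over divisors of \<open>n\<close>, whose order can be
  exchanged.\<close>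

lemma gcd_eq_sum_totient:
  fixes m n :: nat
  shows "gcd m n = (\<Sum>d | d dvd n \<and> d dvd m. totient d)"
proof -
  have "(d dvd n \<and> d dvd m) = (d dvd gcd m n)" for d by auto
  then show ?thesis by (simp only: totient_divisor_sum)
qed

lemma menon_identity:
  fixes n :: nat
  assumes "n > 0"
  shows "(\<Sum>k\<in>totatives n. gcd (k - 1) n) = card {d. d dvd n} * totient n"
proof (cases "n = 1")
  case True
  then show ?thesis by simp
next
  case False
  with assms have n: "n > 1" by simp
  have "(\<Sum>k\<in>totatives n. gcd (k - 1) n) =
      (\<Sum>k\<in>totatives n. \<Sum>d | d \<in> {d. d dvd n} \<and> d dvd k - 1. totient d)"
    by (subst gcd_eq_sum_totient) simp
  also have "\<dots> = (\<Sum>d | d dvd n. \<Sum>k | k \<in> totatives n \<and> d dvd k - 1. totient d)"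
    using assms by (intro sum.swap_restrict) auto
  also have "\<dots> = (\<Sum>d | d dvd n. totient n)"
  proof (rule sum.cong[OF refl])
    fix d assume "d \<in> {d. d dvd n}"
    then have d: "d dvd n" by simp
    have "{k. k \<in> totatives n \<and> d dvd k - 1} = {k \<in> totatives n. [k = 1] (mod d)}"
    proof (rule Collect_cong, rule conj_cong[OF refl])
      fix k assume "k \<in> totatives n"
      \<comment> \<open>This keeps the truncated subtraction in \<open>k - 1\<close> honest.\<close>
      then have "1 \<le> k" by (simp add: in_totatives_iff)
      then show "d dvd k - 1 \<longleftrightarrow> [k = 1] (mod d)"
        by (simp add: cong_altdef_nat)
    qed
    then show "(\<Sum>k | k \<in> totatives n \<and> d dvd k - 1. totient d) = totient n"
      using card_totatives_cong_mult_totient[OF n d, of 1] by simp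
  qed
  finally show ?thesis by simp
qed

lemma sum_cos_unity:
  fixes m :: nat
  assumes "m > 0"
  shows "(\<Sum>j = 1..m. cos (2 * pi * real j / real m)) = (if m = 1 then 1 else 0)"
proof (cases "m = 1")
  case True
  then show ?thesis by simp
next
  case False
  with assms have m: "m > 1" by simp
  let ?f = "\<lambda>j. cos (2 * pi * real j / real m)"
  have "(\<Sum>j = 1..m. ?f j) = (\<Sum>j<m. ?f (Suc j))"
    by (simp add: sum.atLeast1_atMost_eq)
  \<comment> \<open>The shift by one is harmless because the terms at \<open>0\<close> and
    \<open>m\<close> are both 1.\<close>
  also have "\<dots> = (\<Sum>j<m. ?f j)"
    using sum.lessThan_Suc[of ?f m] sum.lessThan_Suc_shift[of ?f m] m by simp
  also have "\<dots> = Re (\<Sum>j<m. cis (2 * pi * real j / real m))"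
    by simp
  also have "(\<Sum>j<m. cis (2 * pi * real j / real m)) = \<Sum>{z::complex. z ^ m = 1}"
    using m by (intro sum.reindex_bij_betw bij_betw_roots_unity) auto
  also have "\<dots> = 0"
    using m by (rule sum_roots_unity)
  finally show ?thesis using m by simp
qed

text \<open>For a divisor \<open>d\<close> of \<open>n\<close>, the multiples of \<open>d\<close> in
  the range run through all \<open>(n/d)\<close>-th roots of unity, so only \<open>d = n\<close>
  contributes.\<close>

lemma sum_gcd_cos:
  fixes n :: nat
  assumes "n > 0"
  shows "(\<Sum>k = 1..n. real (gcd k n) * cos (2 * pi * real k / real n)) = real (totient n)"
proof -
  let ?f = "\<lambda>k. cos (2 * pi * real k / real n)"
  have "(\<Sum>k = 1..n. real (gcd k n) * ?f k) =
      (\<Sum>k = 1..n. \<Sum>d | d \<in> {d. d dvd n} \<and> d dvd k. real (totient d) * ?f k)"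
    by (subst gcd_eq_sum_totient) (simp add: sum_distrib_right)
  also have "\<dots> = (\<Sum>d | d dvd n. \<Sum>k | k \<in> {1..n} \<and> d dvd k. real (totient d) * ?f k)"
    using assms by (intro sum.swap_restrict) auto
  also have "\<dots> = (\<Sum>d | d dvd n. if d = n then real (totient n) else 0)"
  proof (rule sum.cong[OF refl])
    fix d assume "d \<in> {d. d dvd n}"
    then obtain m where n: "n = d * m" by auto
    with assms have pos: "d > 0" "m > 0" by auto
    have "{k. k \<in> {1..n} \<and> d dvd k} = (\<lambda>j. d * j) ` {1..m}"
      using pos by (auto simp: n)
    then have "(\<Sum>k | k \<in> {1..n} \<and> d dvd k. real (totient d) * ?f k) =
        (\<Sum>j = 1..m. real (totient d) * ?f (d * j))"
      using pos by (simp add: sum.reindex inj_on_def)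
    also have "\<dots> = real (totient d) * (\<Sum>j = 1..m. cos (2 * pi * real j / real m))"
      using pos by (simp add: n sum_distrib_left mult.assoc)
    \<comment> \<open>With \<open>n = d * m\<close> and \<open>d > 0\<close>, the exceptional case
      \<open>m = 1\<close> is exactly \<open>d = n\<close>.\<close>
    also have "\<dots> = (if d = n then real (totient n) else 0)"
      using pos by (subst sum_cos_unity) (auto simp: n)
    finally show "(\<Sum>k | k \<in> {1..n} \<and> d dvd k. real (totient d) * ?f k) =
        (if d = n then real (totient n) else 0)" .
  qed
  also have "\<dots> = real (totient n)"
    using assms by simp
  finally show ?thesis .
qed

theorem mainTheorem4:
  fixes n :: nat
  assumes "n > 0"
  shows "real (divisor_tau n) =
    real (\<Sum>k | 1 \<le> k \<and> k \<le> n \<and> gcd k n = 1. gcd (k - 1) n) /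
    (\<Sum>k = 1..n. real (gcd k n) * cos (2 * pi * real k / real n))"
proof -
  have "{k. 1 \<le> k \<and> k \<le> n \<and> gcd k n = 1} = totatives n"
    by (auto simp: in_totatives_iff intro: gcd_eq_1_imp_coprime simp del: One_nat_def)
  \<comment> \<open>The factor \<open>totient n\<close> is positive and cancels from the
    quotient.\<close>
  then show ?thesis
    using assms by (simp only: menon_identity sum_gcd_cos) (simp add: divisor_tau_def)
qed

end
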